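(* Let $L,U$ be $\mathbb F$-optional processes of class (D) on $[0,T]$. Assume that $L,U$ are left-limited and that $$\limsup_{s\downarrow t}L_s<\liminf_{s\downarrow t}U_s,\qquad L_{t-}<U_{t-},\qquad t\in[0,T].$$ Then the weak Mokobodzki condition holds for $L,U$, i.e. there exists a semimartingale $X$ such that $L\le X\le U$.
   Context: $T>0$; $B$ is a standard $d$-dimensional Brownian motion on a probability space $(\Omega,\mathcal F,P)$; $\mathbb F=(\mathcal F_t)_{0\le t\le T}$ is the standard augmentation of the filtration generated by $B$. An $\mathbb F$-progressively measurable process $X$ is of class (D) if the family $\{X_\tau:\tau \text{ a stopping time with values in } [0,T]\}$ is uniformly integrable. "Left-limited" means that left limits exist, and $L_{t-}=\lim_{s\uparrow t}L_s$, $U_{t-}=\lim_{s\uparrow t}U_s$. At the endpoints of $[0,T]$ each inequality is read only where the limits make sense (left limits for $t>0$, right limits for $t<T$). For processes, $L\le X\le U$ means $L_t\le X_t\le U_t$ for all $t\in[0,T]$, $P$-a.s. A semimartingale is a sum of an $\mathbb F$-local martingale and an $\mathbb F$-adapted process of finite variation on $[0,T]$ (not necessarily càdlàg).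
   Formalization: The formal theorem additionally assumes L ≤ U on [0,T], P-a.s.; without it the claim fails (L = 2·1_{t=T}, U = 1 meets all hypotheses but L_T > U_T), and L ≤ U is necessary for the conclusion. *)

theory Defs
  imports "HOL-Probability.Probability"
begin

text \<open>
  A real process is a map \<open>X t \<omega>\<close>; only its values for \<open>t \<in> {0..T}\<close> and \<open>\<omega>\<close> in the underlying
  space matter. A filtration is a family \<open>F\<close> of measure spaces of which only the space and the
  \<open>\<sigma>\<close>-algebras are used.
\<close>

section \<open>Brownian motion and its augmented filtration\<close>

definition brownian_motion ::
    "'a measure \<Rightarrow> real set \<Rightarrow> (real \<Rightarrow> 'a \<Rightarrow> real ^ 'd) \<Rightarrow> bool" where
  "brownian_motion M I B \<longleftrightarrow>
     prob_space M \<and>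
     (\<forall>t\<in>I. B t \<in> borel_measurable M) \<and>
     (AE \<omega> in M. B 0 \<omega> = 0) \<and>
     (AE \<omega> in M. continuous_on I (\<lambda>t. B t \<omega>)) \<and>
     (\<forall>s\<in>I. \<forall>t\<in>I. s < t \<longrightarrow>
        distributed M lborel (\<lambda>\<omega>. B t \<omega> - B s \<omega>)
          (\<lambda>x. ennreal (\<Prod>i\<in>UNIV. normal_density 0 (sqrt (t - s)) (x $ i)))) \<and>
     (\<forall>(n::nat) (t :: nat \<Rightarrow> real). (\<forall>i\<le>n. t i \<in> I) \<and> (\<forall>i<n. t i \<le> t (Suc i)) \<longrightarrow>
        prob_space.indep_vars M (\<lambda>_. borel) (\<lambda>i \<omega>. B (t (Suc i)) \<omega> - B (t i) \<omega>) {..<n})"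

text \<open>
  The generators include every subset of a null event of \<open>M\<close>, so that the \<open>\<sigma>\<close>-algebras live on
  \<^term>\<open>completion M\<close>, which is the underlying measure in everything that follows.
\<close>

definition augmented_filtration ::
    "'a measure \<Rightarrow> real set \<Rightarrow> (real \<Rightarrow> 'a \<Rightarrow> 'b::topological_space) \<Rightarrow> real \<Rightarrow> 'a measure" where
  "augmented_filtration M I B t =
     sigma (space M)
       ({B s -` A \<inter> space M | s A. s \<in> I \<and> s \<le> t \<and> A \<in> sets borel} \<union> null_sets (completion M))"

section \<open>Measurability of processes\<close>

definition adapted :: "(real \<Rightarrow> 'a measure) \<Rightarrow> real \<Rightarrow> (real \<Rightarrow> 'a \<Rightarrow> real) \<Rightarrow> bool" where
  "adapted F T X \<longleftrightarrow> (\<forall>t\<in>{0..T}. X t \<in> borel_measurable (F t))"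

definition progressively_measurable ::
    "(real \<Rightarrow> 'a measure) \<Rightarrow> real \<Rightarrow> (real \<Rightarrow> 'a \<Rightarrow> real) \<Rightarrow> bool" where
  "progressively_measurable F T X \<longleftrightarrow>
     (\<forall>t\<in>{0..T}. (\<lambda>(s, \<omega>). X s \<omega>) \<in> borel_measurable (restrict_space borel {0..t} \<Otimes>\<^sub>M F t))"

definition left_limited :: "real \<Rightarrow> (real \<Rightarrow> real) \<Rightarrow> bool" where
  "left_limited T f \<longleftrightarrow> (\<forall>t\<in>{0<..T}. \<exists>l. (f \<longlongrightarrow> l) (at_left t))"

definition cadlag :: "real \<Rightarrow> (real \<Rightarrow> real) \<Rightarrow> bool" where
  "cadlag T f \<longleftrightarrow> (\<forall>t\<in>{0..<T}. continuous (at_right t) f) \<and> left_limited T f"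

definition optional_algebra :: "'a set \<Rightarrow> (real \<Rightarrow> 'a measure) \<Rightarrow> real \<Rightarrow> (real \<times> 'a) measure" where
  "optional_algebra \<Omega> F T =
     sigma ({0..T} \<times> \<Omega>)
       {(\<lambda>(t, \<omega>). X t \<omega>) -` A \<inter> ({0..T} \<times> \<Omega>) | X A.
          adapted F T X \<and> (\<forall>\<omega>\<in>\<Omega>. cadlag T (\<lambda>t. X t \<omega>)) \<and> A \<in> sets (borel :: real measure)}"

definition optional_process ::
    "'a set \<Rightarrow> (real \<Rightarrow> 'a measure) \<Rightarrow> real \<Rightarrow> (real \<Rightarrow> 'a \<Rightarrow> real) \<Rightarrow> bool" where
  "optional_process \<Omega> F T X \<longleftrightarrow> (\<lambda>(t, \<omega>). X t \<omega>) \<in> borel_measurable (optional_algebra \<Omega> F T)"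

section \<open>Class (D)\<close>

text \<open>
  For \<open>[0,T]\<close>-valued \<open>\<tau>\<close> the library predicate \<^const>\<open>stopping_time\<close>, which quantifies over all real
  times, imposes nothing at times outside \<open>[0,T]\<close>.
\<close>

definition bounded_stopping_times :: "'a set \<Rightarrow> (real \<Rightarrow> 'a measure) \<Rightarrow> real \<Rightarrow> ('a \<Rightarrow> real) set" where
  "bounded_stopping_times \<Omega> F T = {\<tau>. stopping_time F \<tau> \<and> (\<forall>\<omega>\<in>\<Omega>. \<tau> \<omega> \<in> {0..T})}"

definition uniformly_integrable :: "'a measure \<Rightarrow> ('a \<Rightarrow> real) set \<Rightarrow> bool" where
  "uniformly_integrable P H \<longleftrightarrow>
     (\<forall>f\<in>H. f \<in> borel_measurable P) \<and>
     (\<forall>\<epsilon>>0. \<exists>K::real. \<forall>f\<in>H.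
        (\<integral>\<^sup>+\<omega>. ennreal \<bar>f \<omega>\<bar> * indicator {\<omega>. \<bar>f \<omega>\<bar> > K} \<omega> \<partial>P) \<le> ennreal \<epsilon>)"

definition class_D ::
    "'a measure \<Rightarrow> (real \<Rightarrow> 'a measure) \<Rightarrow> real \<Rightarrow> (real \<Rightarrow> 'a \<Rightarrow> real) \<Rightarrow> bool" where
  "class_D P F T X \<longleftrightarrow>
     progressively_measurable F T X \<and>
     uniformly_integrable P {\<lambda>\<omega>. X (\<tau> \<omega>) \<omega> | \<tau>. \<tau> \<in> bounded_stopping_times (space P) F T}"

section \<open>Semimartingales\<close>

definition martingale ::
    "'a measure \<Rightarrow> (real \<Rightarrow> 'a measure) \<Rightarrow> real \<Rightarrow> (real \<Rightarrow> 'a \<Rightarrow> real) \<Rightarrow> bool" where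
  "martingale P F T X \<longleftrightarrow>
     adapted F T X \<and>
     (\<forall>t\<in>{0..T}. integrable P (X t)) \<and>
     (\<forall>s t. 0 \<le> s \<and> s \<le> t \<and> t \<le> T \<longrightarrow> (AE \<omega> in P. real_cond_exp P (F s) (X t) \<omega> = X s \<omega>))"

text \<open>On the closed interval \<open>[0,T]\<close> a localizing sequence must eventually equal \<open>T\<close>.\<close>

definition local_martingale ::
    "'a measure \<Rightarrow> (real \<Rightarrow> 'a measure) \<Rightarrow> real \<Rightarrow> (real \<Rightarrow> 'a \<Rightarrow> real) \<Rightarrow> bool" where
  "local_martingale P F T X \<longleftrightarrow>
     adapted F T X \<and>
     (\<forall>\<omega>\<in>space P. cadlag T (\<lambda>t. X t \<omega>)) \<and>
     (\<exists>\<tau> :: nat \<Rightarrow> 'a \<Rightarrow> real.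
        (\<forall>n. \<tau> n \<in> bounded_stopping_times (space P) F T) \<and>
        (AE \<omega> in P. incseq (\<lambda>n. \<tau> n \<omega>)) \<and>
        (AE \<omega> in P. eventually (\<lambda>n. \<tau> n \<omega> = T) sequentially) \<and>
        (\<forall>n. martingale P F T (\<lambda>t \<omega>. X (min t (\<tau> n \<omega>)) \<omega>)))"

definition finite_variation :: "real \<Rightarrow> (real \<Rightarrow> real) \<Rightarrow> bool" where
  "finite_variation T f \<longleftrightarrow>
     (\<exists>K. \<forall>(n::nat) (t :: nat \<Rightarrow> real).
        (\<forall>i\<le>n. t i \<in> {0..T}) \<and> (\<forall>i<n. t i \<le> t (Suc i)) \<longrightarrow>
        (\<Sum>i<n. \<bar>f (t (Suc i)) - f (t i)\<bar>) \<le> K)"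

text \<open>The finite variation part, and hence a semimartingale, need not be cadlag.\<close>

definition semimartingale ::
    "'a measure \<Rightarrow> (real \<Rightarrow> 'a measure) \<Rightarrow> real \<Rightarrow> (real \<Rightarrow> 'a \<Rightarrow> real) \<Rightarrow> bool" where
  "semimartingale P F T X \<longleftrightarrow>
     (\<exists>N V. local_martingale P F T N \<and>
        adapted F T V \<and> (\<forall>\<omega>\<in>space P. finite_variation T (\<lambda>t. V t \<omega>)) \<and>
        (\<forall>t\<in>{0..T}. \<forall>\<omega>\<in>space P. X t \<omega> = N t \<omega> + V t \<omega>))"

section \<open>The weak Mokobodzki condition\<close>

definition process_le ::
    "'a measure \<Rightarrow> real \<Rightarrow> (real \<Rightarrow> 'a \<Rightarrow> real) \<Rightarrow> (real \<Rightarrow> 'a \<Rightarrow> real) \<Rightarrow> bool" where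
  "process_le P T X Y \<longleftrightarrow> (AE \<omega> in P. \<forall>t\<in>{0..T}. X t \<omega> \<le> Y t \<omega>)"

definition weak_mokobodzki ::
    "'a measure \<Rightarrow> (real \<Rightarrow> 'a measure) \<Rightarrow> real \<Rightarrow> (real \<Rightarrow> 'a \<Rightarrow> real) \<Rightarrow> (real \<Rightarrow> 'a \<Rightarrow> real) \<Rightarrow> bool" where
  "weak_mokobodzki P F T L U \<longleftrightarrow>
     (\<exists>X. semimartingale P F T X \<and> process_le P T L X \<and> process_le P T X U)"

end

theory Submission
  imports Defs
begin

text \<open>
  The semimartingale is constructed path by path and has no martingale part. For paths \<open>f \<le> g\<close> of
  \<open>L\<close> and \<open>U\<close> put \<open>v t = sup\<^bsub>s \<le> t\<^esub> min (f s) (inf\<^bsub>s \<le> r \<le> t\<^esub> (g r))\<close>: the path that stays constant as long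
  as it can and is otherwise pushed up by \<open>f\<close> and down by \<open>g\<close>. Then \<open>f \<le> v \<le> g\<close> is immediate, by
  taking \<open>s = t\<close> and \<open>r = t\<close>. Two things remain: \<open>v\<close> has finite variation, and it is adapted.

  Finite variation is where the hypotheses on the one-sided limits enter. They say that every time
  has a left and a right neighbourhood on which some constant \<open>c\<close> satisfies \<open>f \<le> c \<le> g\<close>. On such an
  interval \<open>v\<close> can only move towards \<open>c\<close> and cannot cross it, hence it is bounded and monotone there
  (\<open>dominated_increments_lazy_path_separated\<close>); by compactness finitely many such intervals and
  their endpoints make up \<open>[0,T]\<close> (\<open>finite_variation_lazy_path\<close>).

  Adaptedness is where the augmentation of the filtration enters. The value \<open>v t\<close> depends only on
  the paths up to time \<open>t\<close>, but through suprema and infima over uncountably many times, and the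
  processes have no right-continuity that would allow a reduction to rational times. The events
  that a fixed level is kept are projections to \<open>\<Omega>\<close> of measurable subsets of \<open>[0,t] \<times> \<Omega>\<close>
  (\<open>measurable_kept_levels\<close>), and such projections are measurable for a complete finite measure.
  This theorem (\<open>measurable_projection\<close>) is proved here: measurable sets of the product arise by the
  Souslin operation from rectangles with a compact and a measurable side
  (\<open>sets_pair_borel_subset_souslin\<close>), and Choquet's capacity argument approximates their projections
  from inside by measurable sets (\<open>projection_inner_approximation\<close>).
\<close>

section \<open>The Souslin operation\<close>

text \<open>
  The result of the Souslin operation on \<open>\<K>\<close>: a scheme \<open>K\<close> attaches a member of \<open>\<K>\<close> to every
  nonempty finite sequence, and a point is in the resulting set if it survives along some infinite
  branch.
\<close>

definition souslin :: "'x set set \<Rightarrow> 'x set set" where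
  "souslin \<K> = {A. \<exists>K. (\<forall>l :: nat list. K l \<in> \<K>) \<and> A = {x. \<exists>\<sigma>. \<forall>n. x \<in> K (map \<sigma> [0..<Suc n])}}"

lemma subset_souslin: "\<K> \<subseteq> souslin \<K>"
proof
  fix A assume "A \<in> \<K>"
  then show "A \<in> souslin \<K>"
    unfolding souslin_def by (intro CollectI exI[of _ "\<lambda>_. A"]) simp
qed

lemma souslin_schemes:
  fixes A :: "nat \<Rightarrow> 'x set"
  assumes "\<And>i::nat. A i \<in> souslin \<K>"
  obtains K :: "nat \<Rightarrow> nat list \<Rightarrow> 'x set" where "\<And>i l. K i l \<in> \<K>"
    and "\<And>i. A i = {x. \<exists>\<sigma>. \<forall>n. x \<in> K i (map \<sigma> [0..<Suc n])}"
proof -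
  have "\<forall>i. \<exists>K. (\<forall>l :: nat list. K l \<in> \<K>) \<and> A i = {x. \<exists>\<sigma>. \<forall>n. x \<in> K (map \<sigma> [0..<Suc n])}"
    using assms unfolding souslin_def by blast
  from choice[OF this] obtain K :: "nat \<Rightarrow> nat list \<Rightarrow> 'x set"
    where "\<forall>i. (\<forall>l. K i l \<in> \<K>) \<and> A i = {x. \<exists>\<sigma>. \<forall>n. x \<in> K i (map \<sigma> [0..<Suc n])}"
    ..
  then show thesis by (intro that) auto
qed

text \<open>
  A branch for the union is a branch for one of the sets together with the index of that set; both
  are coded in the first entry, so that every finite sequence determines the set of the scheme.
\<close>

lemma souslin_UN:
  fixes A :: "nat \<Rightarrow> 'x set"
  assumes "\<And>i. A i \<in> souslin \<K>"
  shows "(\<Union>i. A i) \<in> souslin \<K>"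
proof -
  obtain K :: "nat \<Rightarrow> nat list \<Rightarrow> 'x set" where K: "\<And>i l. K i l \<in> \<K>" and A: "\<And>i. A i = {x. \<exists>\<sigma>. \<forall>n. x \<in> K i (map \<sigma> [0..<Suc n])}"
    by (rule souslin_schemes[of A, OF assms], rule that)
  define K' where "K' l = (case l of [] \<Rightarrow> K 0 []
      | y # ys \<Rightarrow> K (fst (prod_decode y)) (snd (prod_decode y) # ys))" for l
  have K': "K' (map \<sigma> [0..<Suc n])
      = K (fst (prod_decode (\<sigma> 0))) (map (\<sigma>(0 := snd (prod_decode (\<sigma> 0)))) [0..<Suc n])" for \<sigma> n
    unfolding map_upt_Suc K'_def by simp
  have "(\<Union>i. A i) = {x. \<exists>\<sigma>. \<forall>n. x \<in> K' (map \<sigma> [0..<Suc n])}"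
  proof (intro equalityI subsetI)
    fix x assume "x \<in> (\<Union>i. A i)"
    then obtain i \<sigma> where \<sigma>: "\<And>n. x \<in> K i (map \<sigma> [0..<Suc n])"
      unfolding A by blast
    have "x \<in> K' (map (\<sigma>(0 := prod_encode (i, \<sigma> 0))) [0..<Suc n])" for n
      using \<sigma>[of n] unfolding K' by simp
    then show "x \<in> {x. \<exists>\<sigma>. \<forall>n. x \<in> K' (map \<sigma> [0..<Suc n])}" by blast
  next
    fix x assume "x \<in> {x. \<exists>\<sigma>. \<forall>n. x \<in> K' (map \<sigma> [0..<Suc n])}"
    then show "x \<in> (\<Union>i. A i)" unfolding K' A by blast
  qed
  moreover have "K' l \<in> \<K>" for l
    by (auto simp: K'_def K split: list.split)
  ultimately show ?thesis unfolding souslin_def by blast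
qed

text \<open>
  A branch for the intersection codes one branch for each of the sets. The pairing function is
  increasing in its second argument, so the first \<open>n + 1\<close> entries already contain the part of the
  branch \<open>i\<close> up to \<open>j\<close>, where \<open>n\<close> codes \<open>(i, j)\<close>.
\<close>

lemma souslin_INT:
  fixes A :: "nat \<Rightarrow> 'x set"
  assumes "\<And>i. A i \<in> souslin \<K>"
  shows "(\<Inter>i. A i) \<in> souslin \<K>"
proof -
  obtain K :: "nat \<Rightarrow> nat list \<Rightarrow> 'x set" where K: "\<And>i l. K i l \<in> \<K>" and A: "\<And>i. A i = {x. \<exists>\<sigma>. \<forall>n. x \<in> K i (map \<sigma> [0..<Suc n])}"
    by (rule souslin_schemes[of A, OF assms], rule that)
  define K' where "K' l = (let (i, j) = prod_decode (length l - 1)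
      in K i (map (\<lambda>k. l ! prod_encode (i, k)) [0..<Suc j]))" for l
  have mono: "prod_encode (i, k) \<le> prod_encode (i, j)" if "k \<le> j" for i j k
    unfolding prod_encode_def triangle_def using that
    by (auto intro!: add_mono div_le_mono mult_le_mono)
  have K': "K' (map \<sigma> [0..<Suc (prod_encode (i, j))]) = K i (map (\<lambda>k. \<sigma> (prod_encode (i, k))) [0..<Suc j])"
    for \<sigma> i j
  proof -
    have "map \<sigma> [0..<Suc (prod_encode (i, j))] ! prod_encode (i, k) = \<sigma> (prod_encode (i, k))"
      if "k \<in> set [0..<Suc j]" for k
      using that mono[of k j i] by (subst nth_map_upt) auto
    then have eq: "map (\<lambda>k. map \<sigma> [0..<Suc (prod_encode (i, j))] ! prod_encode (i, k)) [0..<Suc j]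
        = map (\<lambda>k. \<sigma> (prod_encode (i, k))) [0..<Suc j]"
      by (rule map_cong[OF refl])
    show ?thesis
      by (simp only: K'_def Let_def length_map length_upt diff_zero diff_Suc_1
        prod_encode_inverse prod.case eq)
  qed
  have "(\<Inter>i. A i) = {x. \<exists>\<sigma>. \<forall>n. x \<in> K' (map \<sigma> [0..<Suc n])}"
  proof (intro equalityI subsetI)
    fix x assume "x \<in> (\<Inter>i. A i)"
    then have "\<forall>i. \<exists>\<sigma>. \<forall>n. x \<in> K i (map \<sigma> [0..<Suc n])"
      unfolding A by blast
    then obtain \<sigma> where \<sigma>: "\<And>i n. x \<in> K i (map (\<sigma> i) [0..<Suc n])"
      by metis
    define \<tau> where "\<tau> m = (let (i, k) = prod_decode m in \<sigma> i k)" for m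
    have "x \<in> K' (map \<tau> [0..<Suc n])" for n
    proof -
      obtain i j where n: "n = prod_encode (i, j)"
        by (metis prod_decode_inverse surj_pair)
      show ?thesis
        using \<sigma>[of i j] unfolding n K' \<tau>_def by simp
    qed
    then show "x \<in> {x. \<exists>\<sigma>. \<forall>n. x \<in> K' (map \<sigma> [0..<Suc n])}" by blast
  next
    fix x assume "x \<in> {x. \<exists>\<sigma>. \<forall>n. x \<in> K' (map \<sigma> [0..<Suc n])}"
    then obtain \<tau> where "\<And>n. x \<in> K' (map \<tau> [0..<Suc n])" by blast
    then have "x \<in> K i (map (\<lambda>k. \<tau> (prod_encode (i, k))) [0..<Suc j])" for i j
      using K' by metis
    then show "x \<in> (\<Inter>i. A i)" unfolding A by blast
  qed
  moreover have "K' l \<in> \<K>" for l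
    by (auto simp: K'_def K split: prod.split)
  ultimately show ?thesis unfolding souslin_def by blast
qed

text \<open>
  The Souslin operation does not commute with complements. The members of \<open>souslin \<K>\<close> whose
  complement is in \<open>souslin \<K>\<close> as well are nevertheless closed under complements and, by the two
  preceding lemmas, under countable unions.
\<close>

lemma sigma_sets_subset_souslin:
  assumes "\<And>G. G \<in> \<G> \<Longrightarrow> G \<subseteq> \<Omega> \<and> G \<in> souslin \<K> \<and> \<Omega> - G \<in> souslin \<K>"
    and "{} \<in> souslin \<K>" "\<Omega> \<in> souslin \<K>"
  shows "sigma_sets \<Omega> \<G> \<subseteq> souslin \<K>"
proof
  fix A assume "A \<in> sigma_sets \<Omega> \<G>"
  then have "A \<subseteq> \<Omega> \<and> A \<in> souslin \<K> \<and> \<Omega> - A \<in> souslin \<K>"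
  proof induction
    case (Compl a)
    then show ?case by (simp add: double_diff)
  next
    case (Union a)
    have eq: "\<Omega> - (\<Union>i. a i) = (\<Inter>i. \<Omega> - a i)"
      by auto
    have "(\<Union>i. a i) \<in> souslin \<K>" "\<Omega> - (\<Union>i. a i) \<in> souslin \<K>"
      unfolding eq using Union.IH by (blast intro!: souslin_UN souslin_INT)+
    with Union.IH show ?case by blast
  qed (use assms in auto)
  then show "A \<in> souslin \<K>" by simp
qed

text \<open>
  Dependent choice along finite sequences. It serves twice: to choose the bounds in the capacity
  argument, and to find an infinite branch in a finitely branching tree.
\<close>

lemma sequence_of_extensions:
  fixes P :: "'x list \<Rightarrow> bool"
  assumes "P []" and "\<And>b. P b \<Longrightarrow> \<exists>j. P (b @ [j])"
  shows "\<exists>m. \<forall>n. P (map m [0..<n])"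
proof -
  obtain j where j: "\<And>b. P b \<Longrightarrow> P (b @ [j b])"
    using assms(2) by metis
  define b where "b = rec_nat [] (\<lambda>_ b. b @ [j b])"
  have b: "b 0 = []" "b (Suc n) = b n @ [j (b n)]" for n
    by (simp_all add: b_def)
  have "P (b n)" for n
    by (induction n) (simp_all add: b assms(1) j)
  moreover have "b n = map (\<lambda>n. j (b n)) [0..<n]" for n
  proof (induction n)
    case (Suc n)
    show ?case using arg_cong[OF Suc.IH, of "\<lambda>x. x @ [j (b n)]"] by (simp add: b(2))
  qed (simp add: b)
  ultimately show ?thesis by metis
qed

definition compact_rectangles :: "'a measure \<Rightarrow> ('b::topological_space \<times> 'a) set set" where
  "compact_rectangles N = {C \<times> E | C E. compact C \<and> E \<in> sets N}"

text \<open>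
  Complements of compact rectangles are not compact rectangles, but open and closed sets of a
  Euclidean space are countable unions of compact sets; this brings both a generating rectangle and
  its complement into reach of the Souslin operation.
\<close>

lemma sets_pair_borel_subset_souslin:
  "sets ((borel :: 'b::euclidean_space measure) \<Otimes>\<^sub>M N) \<subseteq> souslin (compact_rectangles N)"
proof -
  let ?S = "souslin (compact_rectangles N :: ('b \<times> 'a) set set)"
  have rect: "C \<times> E \<in> ?S" if "compact C" "E \<in> sets N" for C E
    using that by (intro subsetD[OF subset_souslin]) (auto simp: compact_rectangles_def)
  have open_times: "G \<times> E \<in> ?S" if G: "open G" and "E \<in> sets N" for G E
  proof -
    obtain C :: "nat \<Rightarrow> 'b set" where C: "\<And>n. compact (C n)" "\<Union>(range C) = G"
      by (rule open_Union_compact_subsets[OF G], rule that, assumption+)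
    have "C n \<times> E \<in> ?S" for n :: nat
      by (rule rect) (use C(1) that(2) in auto)
    then have "(\<Union>n. C n \<times> E) \<in> ?S"
      by (rule souslin_UN)
    moreover have "(\<Union>n. C n \<times> E) = G \<times> E"
      unfolding C(2)[symmetric] by blast
    ultimately show ?thesis by simp
  qed
  have Un: "A \<union> B \<in> ?S" if "A \<in> ?S" "B \<in> ?S" for A B
  proof -
    have "(\<Union>i::nat. if i = 0 then A else B) = A \<union> B"
      by (auto split: if_splits)
    then show ?thesis
      using souslin_UN[of "\<lambda>i. if i = 0 then A else B"] that by auto
  qed
  have closed_times: "C \<times> E \<in> ?S" if "closed C" "E \<in> sets N" for C E
  proof -
    have "(C \<inter> cball 0 (real n)) \<times> E \<in> ?S" for n
      by (rule rect[OF closed_Int_compact[OF that(1) compact_cball] that(2)])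
    then have "(\<Union>n. (C \<inter> cball 0 (real n)) \<times> E) \<in> ?S"
      by (rule souslin_UN)
    moreover have "(\<Union>n. C \<inter> cball 0 (real n)) = C"
      using real_arch_simple by (auto simp: dist_norm)
    then have "(\<Union>n. (C \<inter> cball 0 (real n)) \<times> E) = C \<times> E"
      by blast
    ultimately show ?thesis by simp
  qed
  have "sets ((borel :: 'b measure) \<Otimes>\<^sub>M N)
      = sigma_sets (UNIV \<times> space N) {C \<times> E | C E. C \<in> {C. closed C} \<and> E \<in> sets N}"
  proof -
    have "sets (borel :: 'b measure) = sigma_sets UNIV {C. closed C}"
      unfolding borel_eq_closed by (rule sets_measure_of) simp
    then have "sets ((borel :: 'b measure) \<Otimes>\<^sub>M N)
        = sets (sigma (UNIV \<times> space N) {C \<times> E | C E. C \<in> {C. closed C} \<and> E \<in> sets N})"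
      using sets_pair_eq[of "{C. closed C}" "borel :: 'b measure" "{UNIV}" "sets N" N "{space N}"]
      by (simp add: sets.space_closed sets.sigma_sets_eq)
    also have "\<dots> = sigma_sets (UNIV \<times> space N) {C \<times> E | C E. C \<in> {C. closed C} \<and> E \<in> sets N}"
      by (rule sets_measure_of) (auto dest: sets.sets_into_space)
    finally show ?thesis .
  qed
  also have "\<dots> \<subseteq> ?S"
  proof (rule sigma_sets_subset_souslin)
    fix G :: "('b \<times> 'a) set" assume "G \<in> {C \<times> E | C E. C \<in> {C. closed C} \<and> E \<in> sets N}"
    then obtain C E where G: "G = C \<times> E" and C: "closed C" and E: "E \<in> sets N"
      by blast
    have "UNIV \<times> space N - C \<times> E = (- C) \<times> space N \<union> UNIV \<times> (space N - E)"
      by auto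
    then have "UNIV \<times> space N - G \<in> ?S"
      using Un[OF open_times[of "- C" "space N"] open_times[of UNIV "space N - E"]] C E
      unfolding G by auto
    then show "G \<subseteq> UNIV \<times> space N \<and> G \<in> ?S \<and> UNIV \<times> space N - G \<in> ?S"
      using closed_times C E sets.sets_into_space[OF E] unfolding G by auto
  next
    show "{} \<in> ?S"
      using closed_times[of "{}" "{}"] by simp
    show "UNIV \<times> space N \<in> ?S"
      using closed_times[of UNIV "space N"] by simp
  qed
  finally show ?thesis .
qed

section \<open>Measurable projections\<close>

text \<open>
  This is Choquet's capacity argument. Restrict the branches to those bounded by a sequence \<open>m\<close>.
  Outer measures are continuous along increasing sequences of arbitrary sets, so the entries of \<open>m\<close>
  can be chosen one after the other with a total loss of at most \<open>\<epsilon>\<close> (the sets \<open>R\<close> below). The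
  measurable set \<open>H n\<close> asks for a bounded sequence of length \<open>n\<close> only, and the sets \<open>H n\<close> decrease;
  hence their intersection has at least the outer measure of the projection minus \<open>\<epsilon>\<close>. This
  intersection is still contained in the projection: bounded branches form a finitely branching
  tree, so there is an infinite branch by Koenig's lemma, and the compact factors along it have a
  common point.
\<close>

lemma projection_inner_approximation:
  fixes A :: "('b::euclidean_space \<times> 'a) set"
  assumes "finite_measure N" and A: "A \<in> souslin (compact_rectangles N)" and "0 < \<epsilon>"
  shows "\<exists>D\<in>sets N. D \<subseteq> snd ` A \<and> outer_measure_of N (snd ` A) \<le> emeasure N D + ennreal \<epsilon>"
proof -
  interpret finite_measure N by fact
  obtain K :: "nat list \<Rightarrow> ('b \<times> 'a) set" where K: "\<And>l. K l \<in> compact_rectangles N"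
    and A: "A = {x. \<exists>\<sigma>. \<forall>n. x \<in> K (map \<sigma> [0..<Suc n])}"
    using A unfolding souslin_def by blast
  from K have "\<forall>l. \<exists>C E. K l = C \<times> E \<and> compact C \<and> E \<in> sets N"
    unfolding compact_rectangles_def by blast
  then obtain C :: "nat list \<Rightarrow> 'b set" and E :: "nat list \<Rightarrow> 'a set"
    where KCE: "\<And>l. K l = C l \<times> E l" and C: "\<And>l. compact (C l)"
    and E: "\<And>l. E l \<in> sets N"
    by metis
  have snd_A: "snd ` A = {\<omega>. \<exists>\<sigma> t. \<forall>n. (t, \<omega>) \<in> K (map \<sigma> [0..<Suc n])}"
    unfolding A by (force simp: image_iff)
  have A_sub: "snd ` A \<subseteq> space N"
    using E sets.sets_into_space unfolding snd_A KCE by blast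

  \<comment> \<open>Only the first \<open>length b\<close> entries of the branch are bounded by \<open>b\<close>; the others are free.\<close>
  define R where "R b = {\<omega>. \<exists>\<sigma> t. (\<forall>i<length b. \<sigma> i \<le> b ! i) \<and> (\<forall>n. (t, \<omega>) \<in> K (map \<sigma> [0..<Suc n]))}"
    for b :: "nat list"
  \<comment> \<open>The points that survive along the finite sequence \<open>l\<close>. These sets are measurable because a
    finite intersection of rectangles is a rectangle.\<close>
  define G where "G l = {\<omega>\<in>space N. \<exists>t. \<forall>n<length l. (t, \<omega>) \<in> K (take (Suc n) l)}" for l
  have R_sub: "R b \<subseteq> space N" for b
    using A_sub unfolding R_def snd_A by blast
  have G_sets: "G l \<in> sets N" for l
  proof (cases "\<exists>t. \<forall>n<length l. t \<in> C (take (Suc n) l)")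
    case True
    then have "G l = {\<omega>\<in>space N. \<forall>n<length l. \<omega> \<in> E (take (Suc n) l)}"
      unfolding G_def KCE by auto
    then show ?thesis using E by simp
  next
    case False
    then have "G l = {}" unfolding G_def KCE by auto
    then show ?thesis by simp
  qed

  have step: "\<exists>j. outer_measure_of N (R b) \<le> outer_measure_of N (R (b @ [j])) + ennreal \<delta>"
    if "0 < \<delta>" for b \<delta>
  proof -
    have un: "R b = (\<Union>j. R (b @ [j]))"
    proof (intro equalityI subsetI)
      fix \<omega> assume "\<omega> \<in> R b"
      then obtain \<sigma> t where \<sigma>: "\<forall>i<length b. \<sigma> i \<le> b ! i" "\<forall>n. (t, \<omega>) \<in> K (map \<sigma> [0..<Suc n])"
        unfolding R_def by blast
      then have "\<forall>i<length (b @ [\<sigma> (length b)]). \<sigma> i \<le> (b @ [\<sigma> (length b)]) ! i"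
        by (auto simp: nth_append less_Suc_eq)
      with \<sigma>(2) show "\<omega> \<in> (\<Union>j. R (b @ [j]))"
        unfolding R_def by blast
    next
      fix \<omega> assume "\<omega> \<in> (\<Union>j. R (b @ [j]))"
      then obtain j \<sigma> t where \<sigma>: "\<forall>i<length (b @ [j]). \<sigma> i \<le> (b @ [j]) ! i"
        "\<forall>n. (t, \<omega>) \<in> K (map \<sigma> [0..<Suc n])"
        unfolding R_def by blast
      then have "\<forall>i<length b. \<sigma> i \<le> b ! i"
        by (metis length_append_singleton less_Suc_eq nth_append)
      with \<sigma>(2) show "\<omega> \<in> R b" unfolding R_def by blast
    qed
    have "R (b @ [j]) \<subseteq> R (b @ [k])" if "j \<le> k" for j k
    proof
      fix \<omega> assume "\<omega> \<in> R (b @ [j])"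
      then obtain \<sigma> t where \<sigma>: "\<forall>i<length (b @ [j]). \<sigma> i \<le> (b @ [j]) ! i"
        "\<forall>n. (t, \<omega>) \<in> K (map \<sigma> [0..<Suc n])"
        unfolding R_def by blast
      have "(b @ [j]) ! i \<le> (b @ [k]) ! i" if "i < length (b @ [j])" for i
        using that \<open>j \<le> k\<close> by (simp add: nth_append)
      then have "\<forall>i<length (b @ [k]). \<sigma> i \<le> (b @ [k]) ! i"
        using \<sigma>(1) by (metis length_append_singleton order_trans)
      with \<sigma>(2) show "\<omega> \<in> R (b @ [k])" unfolding R_def by blast
    qed
    then have "incseq (\<lambda>j. R (b @ [j]))"
      unfolding incseq_def by blast
    then have SUP: "(SUP j. outer_measure_of N (R (b @ [j]))) = outer_measure_of N (R b)"
      unfolding un by (intro SUP_outer_measure_of_incseq R_sub)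
    have "outer_measure_of N (R b) \<le> emeasure N (space N)"
      using outer_measure_of_mono[OF R_sub[of b], of N] by simp
    then have "outer_measure_of N (R b) < \<infinity>"
      using emeasure_finite[of "space N"] by (auto simp: less_top[symmetric] top_unique)
    then have "outer_measure_of N (R b) < outer_measure_of N (R b) + ennreal \<delta>"
      using \<open>0 < \<delta>\<close>
        ennreal_add_left_cancel_less[of "outer_measure_of N (R b)" 0 "ennreal \<delta>"] by auto
    also have "\<dots> = (SUP j. outer_measure_of N (R (b @ [j])) + ennreal \<delta>)"
      unfolding SUP[symmetric] by (subst ennreal_SUP_add_left) auto
    finally show ?thesis
      unfolding less_SUP_iff by (blast intro: less_imp_le)
  qed

  have "\<exists>m. \<forall>n. outer_measure_of N (snd ` A)
      \<le> outer_measure_of N (R (map m [0..<n])) + ennreal (\<epsilon> * (1 - (1/2) ^ length (map m [0..<n])))"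
  proof (rule sequence_of_extensions)
    show "outer_measure_of N (snd ` A)
      \<le> outer_measure_of N (R []) + ennreal (\<epsilon> * (1 - (1/2) ^ length ([] :: nat list)))"
      unfolding snd_A R_def by simp
  next
    fix b :: "nat list"
    assume b: "outer_measure_of N (snd ` A)
      \<le> outer_measure_of N (R b) + ennreal (\<epsilon> * (1 - (1/2) ^ length b))"
    let ?\<delta> = "\<epsilon> * (1/2) ^ Suc (length b)"
    obtain j where j: "outer_measure_of N (R b) \<le> outer_measure_of N (R (b @ [j])) + ennreal ?\<delta>"
      using step[of ?\<delta> b] \<open>0 < \<epsilon>\<close> by auto
    have "ennreal ?\<delta> + ennreal (\<epsilon> * (1 - (1/2) ^ length b))
        = ennreal (\<epsilon> * (1 - (1/2) ^ length (b @ [j])))"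
      using \<open>0 < \<epsilon>\<close> by (subst ennreal_plus[symmetric]) (auto simp: algebra_simps power_le_one)
    then have "outer_measure_of N (snd ` A)
        \<le> outer_measure_of N (R (b @ [j])) + ennreal (\<epsilon> * (1 - (1/2) ^ length (b @ [j])))"
      using order_trans[OF b add_right_mono[OF j]] by (metis add.assoc)
    then show "\<exists>j. outer_measure_of N (snd ` A)
        \<le> outer_measure_of N (R (b @ [j])) + ennreal (\<epsilon> * (1 - (1/2) ^ length (b @ [j])))"
      by blast
  qed
  then obtain m where m: "\<And>n. outer_measure_of N (snd ` A)
      \<le> outer_measure_of N (R (map m [0..<n])) + ennreal (\<epsilon> * (1 - (1/2) ^ length (map m [0..<n])))"
    by blast

  define H where "H n = (\<Union>l\<in>{l. length l = n \<and> (\<forall>i<n. l ! i \<le> m i)}. G l)" for n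
  have H_sets: "H n \<in> sets N" for n
    unfolding H_def by (rule sets.countable_UN') (auto simp: G_sets)
  have G_take: "G l \<subseteq> G (take k l)" for k l
  proof
    fix \<omega> assume "\<omega> \<in> G l"
    then obtain t where "\<omega> \<in> space N" "\<forall>n<length l. (t, \<omega>) \<in> K (take (Suc n) l)"
      unfolding G_def by blast
    moreover have "take (Suc n) (take k l) = take (Suc n) l" if "n < length (take k l)" for n
      using that by (simp add: take_take)
    ultimately show "\<omega> \<in> G (take k l)"
      unfolding G_def by auto
  qed
  have G_map: "G (map \<sigma> [0..<n]) = {\<omega>\<in>space N. \<exists>t. \<forall>k<n. (t, \<omega>) \<in> K (map \<sigma> [0..<Suc k])}" for \<sigma> n
  proof -
    have "take (Suc k) (map \<sigma> [0..<n]) = map \<sigma> [0..<Suc k]" if "k < n" for k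
      using that by (simp add: take_map del: upt_Suc)
    then show ?thesis
      unfolding G_def by (simp del: upt_Suc cong: conj_cong)
  qed
  have R_H: "R (map m [0..<n]) \<subseteq> H n" for n
  proof
    fix \<omega> assume \<omega>: "\<omega> \<in> R (map m [0..<n])"
    then obtain \<sigma> t where \<sigma>: "\<forall>i<n. \<sigma> i \<le> m i" "\<forall>n. (t, \<omega>) \<in> K (map \<sigma> [0..<Suc n])"
      unfolding R_def by auto
    have "\<omega> \<in> space N"
      using \<omega> R_sub by blast
    then have "\<omega> \<in> G (map \<sigma> [0..<n])"
      unfolding G_map using \<sigma>(2) by blast
    moreover have "length (map \<sigma> [0..<n]) = n" "\<forall>i<n. map \<sigma> [0..<n] ! i \<le> m i"
      using \<sigma>(1) by simp_all
    ultimately show "\<omega> \<in> H n"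
      unfolding H_def by blast
  qed
  have H_dec: "decseq H"
  proof (rule decseq_SucI)
    fix n
    show "H (Suc n) \<subseteq> H n"
    proof
      fix \<omega> assume "\<omega> \<in> H (Suc n)"
      then obtain l where "length l = Suc n" "\<forall>i<Suc n. l ! i \<le> m i" "\<omega> \<in> G l"
        unfolding H_def by blast
      then have "length (take n l) = n" "\<forall>i<n. take n l ! i \<le> m i" "\<omega> \<in> G (take n l)"
        using G_take by auto
      then show "\<omega> \<in> H n" unfolding H_def by blast
    qed
  qed
  have le_H: "outer_measure_of N (snd ` A) \<le> emeasure N (H n) + ennreal \<epsilon>" for n
  proof -
    have "outer_measure_of N (R (map m [0..<n])) \<le> emeasure N (H n)"
      using outer_measure_of_mono[OF R_H] H_sets by (metis outer_measure_of_eq)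
    moreover have "ennreal (\<epsilon> * (1 - (1/2) ^ length (map m [0..<n]))) \<le> ennreal \<epsilon>"
      using \<open>0 < \<epsilon>\<close> by (intro ennreal_leI) (simp add: algebra_simps)
    ultimately show ?thesis
      using m[of n] by (meson add_mono order_trans)
  qed

  let ?D = "\<Inter>n. H n"
  have "?D \<subseteq> snd ` A"
  proof
    fix \<omega> assume \<omega>: "\<omega> \<in> ?D"
    \<comment> \<open>The nodes of the tree that have bounded extensions of every length.\<close>
    define W where "W b \<longleftrightarrow> (\<forall>n\<ge>length b. \<exists>l. length l = n \<and> take (length b) l = b
        \<and> (\<forall>i<n. l ! i \<le> m i) \<and> \<omega> \<in> G l)" for b
    have "\<exists>\<sigma>. \<forall>n. W (map \<sigma> [0..<n])"
    proof (rule sequence_of_extensions)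
      have "\<exists>l. length l = n \<and> (\<forall>i<n. l ! i \<le> m i) \<and> \<omega> \<in> G l" for n
        using \<omega> unfolding H_def by blast
      then show "W []" unfolding W_def by simp
    next
      fix b assume b: "W b"
      let ?k = "length b"
      show "\<exists>j. W (b @ [j])"
      proof (rule ccontr)
        assume "\<nexists>j. W (b @ [j])"
        then have "\<not> W (b @ [j])" for j
          by blast
        then have "\<forall>j. \<exists>n\<ge>Suc ?k. \<forall>l. length l = n \<longrightarrow> take (Suc ?k) l = b @ [j]
            \<longrightarrow> (\<forall>i<n. l ! i \<le> m i) \<longrightarrow> \<omega> \<notin> G l"
          unfolding W_def length_append_singleton by blast
        then obtain f where f: "\<And>j. f j \<ge> Suc ?k"
          and fail: "\<And>j l. length l = f j \<Longrightarrow> take (Suc ?k) l = b @ [j]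
            \<Longrightarrow> (\<forall>i<f j. l ! i \<le> m i) \<Longrightarrow> \<omega> \<notin> G l"
          by metis
        \<comment> \<open>Only finitely many children of \<open>b\<close> respect the bound. If each of them failed at some length,
          then at the largest of these lengths there would be no bounded extension of \<open>b\<close> at all.\<close>
        define n where "n = Max (f ` {..m ?k})"
        have n: "f j \<le> n" if "j \<le> m ?k" for j
          unfolding n_def using that by (intro Max_ge) auto
        have "Suc ?k \<le> n" using n[of 0] f[of 0] by simp
        then obtain l where l: "length l = n" "take ?k l = b" "\<forall>i<n. l ! i \<le> m i" "\<omega> \<in> G l"
          using b unfolding W_def by (meson Suc_leD)
        let ?j = "l ! ?k"
        have "?j \<le> m ?k" using l \<open>Suc ?k \<le> n\<close> by simp
        then have "f ?j \<le> n" by (rule n)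
        have "take (Suc ?k) (take (f ?j) l) = take (Suc ?k) l"
          using f[of ?j] by (simp add: min_def)
        also have "\<dots> = b @ [?j]"
          using l \<open>Suc ?k \<le> n\<close> by (simp add: take_Suc_conv_app_nth)
        finally have "\<omega> \<notin> G (take (f ?j) l)"
          using l \<open>f ?j \<le> n\<close> by (intro fail) auto
        then show False using l(4) G_take by blast
      qed
    qed
    then obtain \<sigma> where \<sigma>: "\<And>n. W (map \<sigma> [0..<n])" by blast
    have pref: "\<exists>t. \<forall>k<n. (t, \<omega>) \<in> K (map \<sigma> [0..<Suc k])" for n
    proof -
      have "\<omega> \<in> G (map \<sigma> [0..<n])"
        using \<sigma>[of n] unfolding W_def by auto
      then show ?thesis unfolding G_map by blast
    qed
    let ?C = "\<lambda>k. C (map \<sigma> [0..<Suc k])"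
    have "?C 0 \<inter> (\<Inter>k\<in>UNIV. ?C k) \<noteq> {}"
    proof (rule compact_imp_fip_image)
      show "compact (?C 0)" by (rule C)
      show "closed (?C k)" for k by (rule compact_imp_closed[OF C])
      fix I' :: "nat set" assume "finite I'"
      then obtain n where "\<forall>k\<in>insert 0 I'. k < n"
        using finite_nat_set_iff_bounded[of "insert 0 I'"] by auto
      with pref[of n] show "?C 0 \<inter> (\<Inter>k\<in>I'. ?C k) \<noteq> {}"
        unfolding KCE by blast
    qed
    then obtain t where "\<forall>k. t \<in> ?C k" by blast
    moreover have "\<omega> \<in> E (map \<sigma> [0..<Suc k])" for k
      using pref[of "Suc k"] unfolding KCE by blast
    ultimately show "\<omega> \<in> snd ` A" unfolding snd_A KCE by blast
  qed
  moreover have "?D \<in> sets N" using H_sets by auto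
  moreover have "outer_measure_of N (snd ` A) \<le> emeasure N ?D + ennreal \<epsilon>"
  proof -
    have "outer_measure_of N (snd ` A) \<le> (INF n. emeasure N (H n) + ennreal \<epsilon>)"
      by (rule INF_greatest) (rule le_H)
    also have "\<dots> = (INF n. emeasure N (H n)) + ennreal \<epsilon>"
      by (rule INF_ennreal_add_const)
    also have "(INF n. emeasure N (H n)) = emeasure N ?D"
      using H_sets H_dec by (intro INF_emeasure_decseq) auto
    finally show ?thesis .
  qed
  ultimately show ?thesis by blast
qed

text \<open>
  The union of inner approximations is a measurable subset of the projection whose measure is the
  outer measure of the projection; a measurable set that contains the projection attains the same
  value. The difference of the two is a null set, so completeness gives measurability.
\<close>

theorem measurable_projection:
  fixes A :: "('b::euclidean_space \<times> 'a) set"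
  assumes "finite_measure N" "complete_measure N" and A: "A \<in> sets (borel \<Otimes>\<^sub>M N)"
  shows "snd ` A \<in> sets N"
proof -
  interpret finite_measure N by fact
  let ?S = "snd ` A"
  have "\<forall>n. \<exists>D\<in>sets N. D \<subseteq> ?S \<and> outer_measure_of N ?S \<le> emeasure N D + ennreal (1 / Suc n)"
    using subsetD[OF sets_pair_borel_subset_souslin A]
    by (intro allI projection_inner_approximation[OF assms(1)]) auto
  then obtain D where D: "\<And>n. D n \<in> sets N" "\<And>n. D n \<subseteq> ?S"
    and le: "\<And>n. outer_measure_of N ?S \<le> emeasure N (D n) + ennreal (1 / Suc n)"
    by metis
  let ?D = "\<Union>n::nat. D n"
  have D': "?D \<in> sets N" "?D \<subseteq> ?S" using D by auto
  have "?S \<subseteq> space N"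
    using sets.sets_into_space[OF A] by (auto simp: space_pair_measure)
  then obtain E where E: "E \<in> sets N" "?S \<subseteq> E" "outer_measure_of N ?S = emeasure N E"
    by (rule bexE[OF outer_measure_of_attain]) auto
  have bound: "measure N E \<le> measure N ?D + 1 / Suc n" for n
  proof -
    have "emeasure N E \<le> emeasure N ?D + ennreal (1 / Suc n)"
      unfolding E(3)[symmetric]
      using D' by (intro order_trans[OF le[of n]] add_right_mono emeasure_mono) auto
    then show ?thesis
      by (simp add: emeasure_eq_measure flip: ennreal_plus)
  qed
  have "measure N E \<le> measure N ?D"
  proof (rule field_le_epsilon)
    fix e :: real assume "0 < e"
    then obtain n where "1 / Suc n < e" by (rule nat_approx_posE)
    with bound[of n] show "measure N E \<le> measure N ?D + e" by linarith
  qed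
  moreover have "?D \<subseteq> E"
    using D'(2) E(2) by (rule order_trans)
  with E(1) D'(1) have "measure N (E - ?D) = measure N E - measure N ?D"
    by (rule finite_measure_Diff)
  ultimately have "measure N (E - ?D) = 0"
    using measure_nonneg[of N "E - ?D"] by linarith
  then have "E - ?D \<in> null_sets N"
    using E(1) D'(1) by (intro null_setsI) (auto simp only: emeasure_eq_measure ennreal_0 sets.Diff)
  moreover have "?S - ?D \<subseteq> E - ?D"
    using E(2) by (rule Diff_mono) (rule order_refl)
  ultimately have "?S - ?D \<in> sets N"
    using complete_measure.complete[OF assms(2)] by metis
  with D'(1) have "?D \<union> (?S - ?D) \<in> sets N"
    by (rule sets.Un)
  also have "?D \<union> (?S - ?D) = ?S"
    using D'(2) by (simp only: Un_Diff_cancel Un_absorb1)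
  finally show ?thesis .
qed

section \<open>The lazy path between two barriers\<close>

text \<open>
  Bounded variation on \<open>{a..b}\<close> in the form that is easiest to glue: \<open>G\<close> plays the part of the
  variation function.
\<close>

definition dominated_increments :: "(real \<Rightarrow> real) \<Rightarrow> real \<Rightarrow> real \<Rightarrow> bool" where
  "dominated_increments v a b \<longleftrightarrow>
     (\<exists>G. \<forall>x y. a \<le> x \<and> x \<le> y \<and> y \<le> b \<longrightarrow> \<bar>v y - v x\<bar> \<le> G y - G x)"

lemma dominated_increments_trivial: "b \<le> a \<Longrightarrow> dominated_increments v a b"
  unfolding dominated_increments_def
  by (intro exI[of _ "\<lambda>_. 0"]) (metis abs_zero antisym diff_self order.refl order_trans)

lemma dominated_increments_trans:
  assumes "dominated_increments v a b" "dominated_increments v b c" "a \<le> b" "b \<le> c"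
  shows "dominated_increments v a c"
proof -
  obtain G H where G: "\<And>x y. a \<le> x \<Longrightarrow> x \<le> y \<Longrightarrow> y \<le> b \<Longrightarrow> \<bar>v y - v x\<bar> \<le> G y - G x"
    and H: "\<And>x y. b \<le> x \<Longrightarrow> x \<le> y \<Longrightarrow> y \<le> c \<Longrightarrow> \<bar>v y - v x\<bar> \<le> H y - H x"
    using assms(1,2) unfolding dominated_increments_def by blast
  define J where "J x = (if x \<le> b then G x - G b else H x - H b)" for x
  have "\<bar>v y - v x\<bar> \<le> J y - J x" if "a \<le> x" "x \<le> y" "y \<le> c" for x y
  proof -
    consider "y \<le> b" | "x \<le> b" "b < y" | "b < x" by linarith
    then show ?thesis
    proof cases
      case 2
      then show ?thesis
        using G[of x b] H[of b y] that by (simp add: J_def)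
    qed (use G[of x y] H[of x y] that in \<open>simp_all add: J_def\<close>)
  qed
  then show ?thesis unfolding dominated_increments_def by blast
qed

lemma finite_variation_if_dominated_increments:
  assumes "dominated_increments v 0 T"
  shows "finite_variation T v"
proof -
  obtain G where G: "\<And>x y. 0 \<le> x \<Longrightarrow> x \<le> y \<Longrightarrow> y \<le> T \<Longrightarrow> \<bar>v y - v x\<bar> \<le> G y - G x"
    using assms unfolding dominated_increments_def by blast
  have mono: "G x \<le> G y" if "0 \<le> x" "x \<le> y" "y \<le> T" for x y
    using G[OF that] by linarith
  show ?thesis
    unfolding finite_variation_def
  proof (intro exI allI impI)
    fix n and t :: "nat \<Rightarrow> real"
    assume t: "(\<forall>i\<le>n. t i \<in> {0..T}) \<and> (\<forall>i<n. t i \<le> t (Suc i))"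
    have "(\<Sum>i<n. \<bar>v (t (Suc i)) - v (t i)\<bar>) \<le> (\<Sum>i<n. G (t (Suc i)) - G (t i))"
      using t by (intro sum_mono G) auto
    also have "\<dots> = G (t n) - G (t 0)"
      by (rule sum_lessThan_telescope)
    also have "\<dots> \<le> G T - G 0"
      using t mono[of "t n" T] mono[of 0 "t 0"] by (auto intro: diff_mono)
    finally show "(\<Sum>i<n. \<bar>v (t (Suc i)) - v (t i)\<bar>) \<le> G T - G 0" .
  qed
qed

text \<open>
  At the right endpoint \<open>v\<close> is arbitrary: it contributes one jump, which \<open>G\<close> accounts for.
\<close>

lemma dominated_increments_endpoint:
  assumes mono: "\<And>x y. p \<le> x \<Longrightarrow> x \<le> y \<Longrightarrow> y < q \<Longrightarrow> v x \<le> v y"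
    and bound: "\<And>x. p \<le> x \<Longrightarrow> x < q \<Longrightarrow> \<bar>v x\<bar> \<le> c"
  shows "dominated_increments v p q"
proof -
  define G where "G x = (if x < q then v x else \<bar>v q\<bar> + 2 * c)" for x
  have "\<bar>v y - v x\<bar> \<le> G y - G x" if "p \<le> x" "x \<le> y" "y \<le> q" for x y
  proof -
    consider "y < q" | "x < q" "y = q" | "x = q" "y = q"
      using \<open>x \<le> y\<close> \<open>y \<le> q\<close> by linarith
    then show ?thesis
    proof cases
      case 1
      then show ?thesis using mono[of x y] that by (simp add: G_def)
    next
      case 2
      then show ?thesis using bound[of x] that by (simp add: G_def)
    qed simp
  qed
  then show ?thesis unfolding dominated_increments_def by blast
qed

lemma dominated_increments_uminus:
  "dominated_increments (\<lambda>x. - v x) a b \<longleftrightarrow> dominated_increments v a b"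
  unfolding dominated_increments_def by (simp add: abs_minus_commute)

text \<open>
  The levels that \<open>f\<close> has reached at some time \<open>s \<le> t\<close> and below which \<open>g\<close> has not fallen since
  then.
\<close>

definition kept_levels :: "(real \<Rightarrow> real) \<Rightarrow> (real \<Rightarrow> real) \<Rightarrow> real \<Rightarrow> real set" where
  "kept_levels f g t = {a. \<exists>s\<in>{0..t}. a \<le> f s \<and> (\<forall>r\<in>{s..t}. a \<le> g r)}"

text \<open>
  The formula is \<open>sup\<^bsub>s \<le> t\<^esub> min (f s) (inf\<^bsub>s \<le> r \<le> t\<^esub> (g r))\<close>: a path that starts at \<open>f 0\<close> and moves only
  when it is pushed up by \<open>f\<close> or down by \<open>g\<close>. The supremum over levels has the advantage that it
  stays inside the reals when \<open>g\<close> is unbounded below.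
\<close>

definition lazy_path :: "(real \<Rightarrow> real) \<Rightarrow> (real \<Rightarrow> real) \<Rightarrow> real \<Rightarrow> real" where
  "lazy_path f g t = Sup (kept_levels f g t)"

lemma kept_levels_downward:
  "a \<in> kept_levels f g t \<Longrightarrow> b \<le> a \<Longrightarrow> b \<in> kept_levels f g t"
  unfolding kept_levels_def by force

context
  fixes f g :: "real \<Rightarrow> real" and T :: real
  assumes le: "\<And>t. 0 \<le> t \<Longrightarrow> t \<le> T \<Longrightarrow> f t \<le> g t"
begin

lemma lower_in_kept_levels: "0 \<le> t \<Longrightarrow> t \<le> T \<Longrightarrow> f t \<in> kept_levels f g t"
  using le unfolding kept_levels_def by force

lemma kept_levels_le_upper: "a \<in> kept_levels f g t \<Longrightarrow> a \<le> g t"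
  unfolding kept_levels_def by force

lemma bdd_above_kept_levels: "bdd_above (kept_levels f g t)"
  using kept_levels_le_upper by (rule bdd_aboveI)

lemma lower_le_lazy_path: "0 \<le> t \<Longrightarrow> t \<le> T \<Longrightarrow> f t \<le> lazy_path f g t"
  unfolding lazy_path_def by (intro cSup_upper lower_in_kept_levels bdd_above_kept_levels)

lemma lazy_path_le_upper: "0 \<le> t \<Longrightarrow> t \<le> T \<Longrightarrow> lazy_path f g t \<le> g t"
  unfolding lazy_path_def using lower_in_kept_levels kept_levels_le_upper
  by (intro cSup_least) auto

text \<open>
  The levels form a down-set, so countably many rational levels describe the path. This reduces the
  measurability of the path to that of the events that a fixed level is kept.
\<close>

lemma less_lazy_path_iff:
  assumes "0 \<le> t" "t \<le> T"
  shows "a < lazy_path f g t \<longleftrightarrow> (\<exists>b\<in>\<rat>. a < b \<and> b \<in> kept_levels f g t)"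
proof -
  have "a < lazy_path f g t \<longleftrightarrow> (\<exists>c\<in>kept_levels f g t. a < c)"
    unfolding lazy_path_def using lower_in_kept_levels[OF assms]
    by (intro less_cSup_iff bdd_above_kept_levels) auto
  also have "\<dots> \<longleftrightarrow> (\<exists>b\<in>\<rat>. a < b \<and> b \<in> kept_levels f g t)"
    using Rats_dense_in_real kept_levels_downward by (meson less_imp_le)
  finally show ?thesis .
qed

context
  fixes p q c :: real
  assumes p: "0 \<le> p" and q: "q \<le> T"
    and sep: "\<And>t. p < t \<Longrightarrow> t < q \<Longrightarrow> f t \<le> c \<and> c \<le> g t"
begin

text \<open>
  A level kept at time \<open>t\<close> was either already kept at time \<open>u\<close> or reached by \<open>f\<close> after \<open>u\<close>, where
  \<open>f \<le> c\<close>.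
\<close>

lemma lazy_path_step_le:
  assumes "p \<le> u" "u < t" "t < q"
  shows "lazy_path f g t \<le> max (lazy_path f g u) c"
  unfolding lazy_path_def[of _ _ t]
proof (rule cSup_least)
  show "kept_levels f g t \<noteq> {}"
    using lower_in_kept_levels[of t] assms p q by auto
  fix a assume "a \<in> kept_levels f g t"
  then obtain s where s: "0 \<le> s" "s \<le> t" "a \<le> f s" "\<forall>r\<in>{s..t}. a \<le> g r"
    unfolding kept_levels_def by auto
  show "a \<le> max (lazy_path f g u) c"
  proof (cases "s \<le> u")
    case True
    then have "a \<in> kept_levels f g u"
      using s assms unfolding kept_levels_def by auto
    then have "a \<le> lazy_path f g u"
      unfolding lazy_path_def by (intro cSup_upper bdd_above_kept_levels)
    then show ?thesis by simp
  next
    case False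
    then show ?thesis using sep[of s] s assms by auto
  qed
qed

text \<open>
  A level below \<open>c\<close> that is kept at time \<open>u\<close> cannot be lost before \<open>q\<close>, because \<open>c \<le> g\<close> there.
\<close>

lemma lazy_path_step_ge:
  assumes "p \<le> u" "u < t" "t < q"
  shows "min (lazy_path f g u) c \<le> lazy_path f g t"
proof (rule dense_le)
  fix a assume "a < min (lazy_path f g u) c" 
  then have "a < lazy_path f g u" and "a < c" by auto
  then obtain b where "a < b" "b \<in> kept_levels f g u"
    using less_lazy_path_iff[of u a] assms p q by auto
  then have "a \<in> kept_levels f g u"
    using kept_levels_downward less_imp_le by blast
  then obtain s where s: "0 \<le> s" "s \<le> u" "a \<le> f s" "\<forall>r\<in>{s..u}. a \<le> g r"
    unfolding kept_levels_def by auto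
  have "a \<le> g r" if "r \<in> {s..t}" for r
    using that s(4) sep[of r] assms \<open>a < c\<close> by (cases "r \<le> u") auto
  then have "a \<in> kept_levels f g t"
    using s assms unfolding kept_levels_def by (auto intro!: bexI[of _ s])
  then show "a \<le> lazy_path f g t"
    unfolding lazy_path_def by (intro cSup_upper bdd_above_kept_levels)
qed

text \<open>
  By the two preceding lemmas the path cannot cross a separating level \<open>c\<close> and can only move
  towards it: on \<open>{p..<q}\<close> it is monotone with values between its value at \<open>p\<close> and \<open>c\<close>.
\<close>

lemma dominated_increments_lazy_path_separated:
  assumes "p < q"
  shows "dominated_increments (lazy_path f g) p q"
proof (cases "lazy_path f g p \<le> c")
  case True
  have below: "lazy_path f g x \<le> c \<and> lazy_path f g p \<le> lazy_path f g x" if "p \<le> x" "x < q" for x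
    using True lazy_path_step_le[of p x] lazy_path_step_ge[of p x] that
    by (cases "x = p") auto
  show ?thesis
  proof (rule dominated_increments_endpoint)
    fix x y assume "p \<le> x" "x \<le> y" "y < q"
    then show "lazy_path f g x \<le> lazy_path f g y"
      using below[of x] lazy_path_step_ge[of x y] by (cases "x = y") auto
  next
    fix x assume "p \<le> x" "x < q"
    then show "\<bar>lazy_path f g x\<bar> \<le> max \<bar>c\<bar> \<bar>lazy_path f g p\<bar>"
      using below[of x] by auto
  qed
next
  case False
  have above: "c \<le> lazy_path f g x \<and> lazy_path f g x \<le> lazy_path f g p" if "p \<le> x" "x < q" for x
    using False lazy_path_step_le[of p x] lazy_path_step_ge[of p x] that
    by (cases "x = p") auto
  have "dominated_increments (\<lambda>x. - lazy_path f g x) p q"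
  proof (rule dominated_increments_endpoint)
    fix x y assume "p \<le> x" "x \<le> y" "y < q"
    then show "- lazy_path f g x \<le> - lazy_path f g y"
      using above[of x] lazy_path_step_le[of x y] by (cases "x = y") auto
  next
    fix x assume "p \<le> x" "x < q"
    then show "\<bar>- lazy_path f g x\<bar> \<le> max \<bar>c\<bar> \<bar>lazy_path f g p\<bar>"
      using above[of x] by auto
  qed
  then show ?thesis by (simp add: dominated_increments_uminus)
qed

end

text \<open>
  Separating levels exist on both sides of every time, so every time has a neighbourhood on which
  the variation is finite, and compactness of \<open>{0..T}\<close> glues these pieces together.
\<close>

lemma finite_variation_lazy_path:
  assumes "0 \<le> T"
    and left: "\<And>t. 0 < t \<Longrightarrow> t \<le> T \<Longrightarrow> \<exists>c. eventually (\<lambda>s. f s \<le> c \<and> c \<le> g s) (at_left t)"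
    and right: "\<And>t. 0 \<le> t \<Longrightarrow> t < T \<Longrightarrow> \<exists>c. eventually (\<lambda>s. f s \<le> c \<and> c \<le> g s) (at_right t)"
  shows "finite_variation T (lazy_path f g)"
proof -
  define P where
    "P a b \<longleftrightarrow> (0 \<le> a \<and> b \<le> T \<longrightarrow> dominated_increments (lazy_path f g) a b)" for a b
  have "P 0 T"
    using \<open>0 \<le> T\<close>
  proof (induction rule: Bolzano)
    case (trans a b c)
    then show ?case unfolding P_def using dominated_increments_trans by auto
  next
    case (local x)
    have "\<exists>d>0. \<forall>a. 0 \<le> a \<and> x - d < a \<and> a \<le> x \<longrightarrow> dominated_increments (lazy_path f g) a x"
    proof (cases "x = 0")
      case True
      then show ?thesis by (intro exI[of _ 1]) (auto intro: dominated_increments_trivial)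
    next
      case False
      then obtain c e where "e < x" and e: "\<And>s. e < s \<Longrightarrow> s < x \<Longrightarrow> f s \<le> c \<and> c \<le> g s"
        using left[of x] local unfolding eventually_at_left_field by force
      then have "dominated_increments (lazy_path f g) a x" if "0 \<le> a" "e < a" "a \<le> x" for a
        using that local
        by (cases "a = x")
          (auto intro: dominated_increments_trivial dominated_increments_lazy_path_separated[of a x c])
      then show ?thesis
        using \<open>e < x\<close> by (intro exI[of _ "x - e"]) auto
    qed
    then obtain d1 where d1: "d1 > 0"
      "\<And>a. 0 \<le> a \<Longrightarrow> x - d1 < a \<Longrightarrow> a \<le> x \<Longrightarrow> dominated_increments (lazy_path f g) a x"
      by blast
    have "\<exists>d>0. \<forall>b. x \<le> b \<and> b < x + d \<and> b \<le> T \<longrightarrow> dominated_increments (lazy_path f g) x b"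
    proof (cases "x = T")
      case True
      then show ?thesis by (intro exI[of _ 1]) (auto intro: dominated_increments_trivial)
    next
      case False
      then obtain c e where "x < e" and e: "\<And>s. x < s \<Longrightarrow> s < e \<Longrightarrow> f s \<le> c \<and> c \<le> g s"
        using right[of x] local unfolding eventually_at_right_field by force
      then have "dominated_increments (lazy_path f g) x b" if "x \<le> b" "b < e" "b \<le> T" for b
        using that local
        by (cases "b = x")
          (auto intro: dominated_increments_trivial dominated_increments_lazy_path_separated[of x b c])
      then show ?thesis
        using \<open>x < e\<close> by (intro exI[of _ "e - x"]) auto
    qed
    then obtain d2 where d2: "d2 > 0"
      "\<And>b. x \<le> b \<Longrightarrow> b < x + d2 \<Longrightarrow> b \<le> T \<Longrightarrow> dominated_increments (lazy_path f g) x b"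
      by blast
    show ?case unfolding P_def
    proof (intro exI[of _ "min d1 d2"] conjI allI impI)
      fix a b assume "a \<le> x \<and> x \<le> b \<and> b - a < min d1 d2" and "0 \<le> a \<and> b \<le> T"
      then show "dominated_increments (lazy_path f g) a b"
        using d1(2)[of a] d2(2)[of b] by (intro dominated_increments_trans[of _ a x b]) auto
    qed (use d1 d2 in auto)
  qed
  then show ?thesis by (intro finite_variation_if_dominated_increments) (simp add: P_def)
qed

end

lemma eventually_separated_at_left:
  fixes f g :: "real \<Rightarrow> real"
  assumes "left_limited T f" "left_limited T g" "0 < t" "t \<le> T"
    and "Lim (at_left t) f < Lim (at_left t) g"
  shows "\<exists>c. eventually (\<lambda>s. f s \<le> c \<and> c \<le> g s) (at_left t)"
proof -
  obtain l u where l: "(f \<longlongrightarrow> l) (at_left t)" and u: "(g \<longlongrightarrow> u) (at_left t)"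
    using assms(1-4) unfolding left_limited_def by force
  then have "l < u"
    using assms(5) tendsto_Lim[OF trivial_limit_at_left_real] by metis
  then obtain c where "l < c" "c < u" using dense by blast
  then have "eventually (\<lambda>s. f s < c) (at_left t)" "eventually (\<lambda>s. c < g s) (at_left t)"
    using order_tendstoD l u by blast+
  then have "eventually (\<lambda>s. f s \<le> c \<and> c \<le> g s) (at_left t)"
    by eventually_elim auto
  then show ?thesis ..
qed

lemma eventually_separated_if_Limsup_less_Liminf:
  fixes f g :: "'b \<Rightarrow> real"
  assumes "Limsup F (\<lambda>s. ereal (f s)) < Liminf F (\<lambda>s. ereal (g s))"
  shows "\<exists>c. eventually (\<lambda>s. f s \<le> c \<and> c \<le> g s) F"
proof -
  obtain c where "Limsup F (\<lambda>s. ereal (f s)) < ereal c" "ereal c < Liminf F (\<lambda>s. ereal (g s))"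
    using ereal_dense2[OF assms] by blast
  then have "eventually (\<lambda>s. ereal (f s) < ereal c) F" "eventually (\<lambda>s. ereal c < ereal (g s)) F"
    using Limsup_lessD less_LiminfD by blast+
  then have "eventually (\<lambda>s. f s \<le> c \<and> c \<le> g s) F"
    by eventually_elim auto
  then show ?thesis ..
qed

section \<open>Measurability of the lazy path\<close>

text \<open>
  The event contains two quantifiers over an uncountable set of times, and each is removed by one
  measurable projection. For the inner quantifier to leave a set that is measurable in \<open>(s, \<omega>)\<close>,
  split the event that \<open>g\<close> falls below \<open>b\<close> on \<open>{s..t}\<close>: it happens at \<open>s\<close> itself, or it happens on
  \<open>{q..t}\<close> for some rational \<open>q > s\<close>.
\<close>

lemma measurable_kept_levels:
  fixes f g :: "real \<Rightarrow> 'a \<Rightarrow> real"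
  assumes N: "finite_measure N" "complete_measure N"
    and f: "(\<lambda>(s, \<omega>). f s \<omega>) \<in> borel_measurable (restrict_space borel {0..t} \<Otimes>\<^sub>M N)"
    and g: "(\<lambda>(s, \<omega>). g s \<omega>) \<in> borel_measurable (restrict_space borel {0..t} \<Otimes>\<^sub>M N)"
    and "0 \<le> t"
  shows "{\<omega>\<in>space N. b \<in> kept_levels (\<lambda>s. f s \<omega>) (\<lambda>s. g s \<omega>) t} \<in> sets N"
proof -
  \<comment> \<open>Clamping the time extends the processes to all real times, so that the projection theorem
    applies to \<open>borel\<close> without restricting it to \<open>{0..t}\<close>.\<close>
  define clamp where "clamp s = max 0 (min t s)" for s :: real
  have "clamp \<in> borel_measurable borel"
    unfolding clamp_def by measurable
  then have [measurable]: "clamp \<in> borel \<rightarrow>\<^sub>M restrict_space borel {0..t}"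
    using \<open>0 \<le> t\<close> by (intro measurable_restrict_space2) (auto simp: clamp_def)
  have pair: "(\<lambda>x. (clamp (fst x), snd x)) \<in> borel \<Otimes>\<^sub>M N \<rightarrow>\<^sub>M restrict_space borel {0..t} \<Otimes>\<^sub>M N"
    by measurable
  define f' where "f' x = f (clamp (fst x)) (snd x)" for x
  define g' where "g' x = g (clamp (fst x)) (snd x)" for x
  have [measurable]: "f' \<in> borel_measurable (borel \<Otimes>\<^sub>M N)" "g' \<in> borel_measurable (borel \<Otimes>\<^sub>M N)"
    unfolding f'_def g'_def using measurable_compose[OF pair f] measurable_compose[OF pair g] by simp_all
  have f'_eq: "f' (s, \<omega>) = f s \<omega>" and g'_eq: "g' (s, \<omega>) = g s \<omega>" if "0 \<le> s" "s \<le> t" for s \<omega>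
    using that by (simp_all add: f'_def g'_def clamp_def)

  define hit where "hit q = {\<omega>\<in>space N. \<exists>r\<in>{0..t}. q \<le> r \<and> g r \<omega> < b}" for q :: real
  have hit: "hit q \<in> sets N" for q
  proof -
    let ?A = "{x\<in>space (borel \<Otimes>\<^sub>M N). 0 \<le> fst x \<and> fst x \<le> t \<and> q \<le> fst x \<and> g' x < b}"
    have "?A \<in> sets (borel \<Otimes>\<^sub>M N)"
      by measurable
    then have "snd ` ?A \<in> sets N"
      by (rule measurable_projection[OF N])
    also have "snd ` ?A = hit q"
    proof (intro equalityI subsetI)
      fix \<omega> assume "\<omega> \<in> snd ` ?A"
      then show "\<omega> \<in> hit q"
        by (auto simp: hit_def space_pair_measure f'_eq g'_eq)
    next
      fix \<omega> assume "\<omega> \<in> hit q"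
      then obtain r where "\<omega> \<in> space N" "0 \<le> r" "r \<le> t" "q \<le> r" "g r \<omega> < b"
        by (auto simp: hit_def)
      then have "(r, \<omega>) \<in> ?A"
        by (simp add: space_pair_measure f'_eq g'_eq)
      then show "\<omega> \<in> snd ` ?A"
        by (rule rev_image_eqI) simp
    qed
    finally show ?thesis .
  qed

  let ?Above = "{x\<in>space (borel \<Otimes>\<^sub>M N). 0 \<le> fst x \<and> fst x \<le> t
      \<and> b \<le> f' x \<and> b \<le> g' x}"
  let ?J = "?Above - (\<Union>q\<in>\<rat>. {..<q} \<times> hit q)"
  have "?Above \<in> sets (borel \<Otimes>\<^sub>M N)"
    by measurable
  then have "?J \<in> sets (borel \<Otimes>\<^sub>M N)"
  proof (rule sets.Diff)
    have "{..<q} \<times> hit q \<in> sets (borel \<Otimes>\<^sub>M N)" for q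
      by (rule pair_measureI) (simp_all add: hit)
    then show "(\<Union>q\<in>\<rat>. {..<q} \<times> hit q) \<in> sets (borel \<Otimes>\<^sub>M N)"
      by (intro sets.countable_UN'' countable_rat)
  qed
  then have "snd ` ?J \<in> sets N"
    by (rule measurable_projection[OF N])
  also have "snd ` ?J = {\<omega>\<in>space N. b \<in> kept_levels (\<lambda>s. f s \<omega>) (\<lambda>s. g s \<omega>) t}"
  proof (intro equalityI subsetI)
    fix \<omega> assume "\<omega> \<in> snd ` ?J"
    then obtain s where s: "\<omega> \<in> space N" "0 \<le> s" "s \<le> t" "b \<le> f s \<omega>" "b \<le> g s \<omega>"
      and no_hit: "\<And>q. q \<in> \<rat> \<Longrightarrow> s < q \<Longrightarrow> \<omega> \<notin> hit q"
      by (auto simp: space_pair_measure f'_eq g'_eq)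
    have "b \<le> g r \<omega>" if "r \<in> {s..t}" for r
    proof (cases "r = s")
      case False
      with that obtain q where "q \<in> \<rat>" "s < q" "q < r"
        using Rats_dense_in_real[of s r] by auto
      then have "\<omega> \<notin> hit q" "r \<in> {0..t}" "q \<le> r"
        using no_hit s that by auto
      with s(1) show ?thesis
        unfolding hit_def by (auto simp: not_less)
    qed (use s in simp)
    with s show "\<omega> \<in> {\<omega>\<in>space N. b \<in> kept_levels (\<lambda>s. f s \<omega>) (\<lambda>s. g s \<omega>) t}"
      unfolding kept_levels_def by auto
  next
    fix \<omega> assume "\<omega> \<in> {\<omega>\<in>space N. b \<in> kept_levels (\<lambda>s. f s \<omega>) (\<lambda>s. g s \<omega>) t}"
    then obtain s where s: "\<omega> \<in> space N" "0 \<le> s" "s \<le> t" "b \<le> f s \<omega>" "\<forall>r\<in>{s..t}. b \<le> g r \<omega>"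
      unfolding kept_levels_def by auto
    then have "(s, \<omega>) \<in> ?J"
      by (auto simp: space_pair_measure f'_eq g'_eq hit_def not_less[symmetric])
    then show "\<omega> \<in> snd ` ?J" by (rule rev_image_eqI) simp
  qed
  finally show ?thesis .
qed

section \<open>The augmented filtration\<close>

lemma null_sets_subset_augmented_filtration:
  "null_sets (completion M) \<subseteq> sets (augmented_filtration M I B t)"
proof -
  have "{B s -` A \<inter> space M | s A. s \<in> I \<and> s \<le> t \<and> A \<in> sets borel} \<union> null_sets (completion M)
      \<subseteq> Pow (space M)"
    using sets.sets_into_space[of _ "completion M"] by auto
  then show ?thesis
    unfolding augmented_filtration_def by (auto simp: sets_measure_of)
qed

lemma subalgebra_augmented_filtration:
  assumes "\<And>s. s \<in> I \<Longrightarrow> B s \<in> borel_measurable M"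
  shows "subalgebra (completion M) (augmented_filtration M I B t)"
proof -
  let ?G = "{B s -` A \<inter> space M | s A. s \<in> I \<and> s \<le> t \<and> A \<in> sets borel} \<union> null_sets (completion M)"
  have G: "?G \<subseteq> sets (completion M)"
  proof (rule Un_least)
    show "{B s -` A \<inter> space M | s A. s \<in> I \<and> s \<le> t \<and> A \<in> sets borel} \<subseteq> sets (completion M)"
      using assms by (auto intro!: sets_completionI_sets measurable_sets)
    show "null_sets (completion M) \<subseteq> sets (completion M)"
      by (rule subsetI) (rule null_setsD2)
  qed
  have "?G \<subseteq> Pow (space M)"
    using order_trans[OF G sets.space_closed] by simp
  then show ?thesis
    using sets.sigma_sets_subset[OF G]
    unfolding subalgebra_def augmented_filtration_def by (simp add: space_measure_of sets_measure_of)
qed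

text \<open>
  The augmentation makes every \<open>\<sigma>\<close>-algebra of the filtration complete for the restricted measure,
  which is what the projection theorem asks for.
\<close>

lemma complete_measure_restr_augmented_filtration:
  assumes "\<And>s. s \<in> I \<Longrightarrow> B s \<in> borel_measurable M"
  shows "complete_measure (restr_to_subalg (completion M) (augmented_filtration M I B t))"
    (is "complete_measure ?N")
proof
  fix A C assume "C \<subseteq> A" "A \<in> null_sets ?N"
  then have "A \<in> null_sets (completion M)"
    using null_sets_restr_to_subalg[OF subalgebra_augmented_filtration[of I B M t, OF assms]] by auto
  then have "C \<in> null_sets (completion M)"
    using \<open>C \<subseteq> A\<close> completion.complete2 by blast
  then show "C \<in> sets ?N"
    using null_sets_subset_augmented_filtration
      sets_restr_to_subalg[OF subalgebra_augmented_filtration[of I B M t, OF assms]] by blast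
qed

section \<open>The weak Mokobodzki condition\<close>

lemma local_martingale_zero:
  assumes "finite_measure P" and sub: "\<And>t. subalgebra P (F t)" and "0 \<le> T"
  shows "local_martingale P F T (\<lambda>_ _. 0)"
proof -
  have "AE \<omega> in P. real_cond_exp P (F s) (\<lambda>_. 0) \<omega> = 0" for s
  proof -
    interpret finite_measure_subalgebra P "F s"
      using assms by (simp add: finite_measure_subalgebra_def finite_measure_subalgebra_axioms_def)
    show ?thesis
      by (rule real_cond_exp_F_meas) auto
  qed
  then have "martingale P F T (\<lambda>_ _. 0)"
    by (simp add: martingale_def adapted_def)
  moreover have "(\<lambda>_. T) \<in> bounded_stopping_times (space P) F T"
    using \<open>0 \<le> T\<close> by (simp add: bounded_stopping_times_def stopping_time_def)
  ultimately show ?thesis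
    unfolding local_martingale_def
    by (auto simp: adapted_def cadlag_def left_limited_def incseq_def intro!: exI[of _ "\<lambda>_ _. T"])
qed

theorem proposition9p1:
  fixes M P :: "'a measure" and T :: real
    and B :: "real \<Rightarrow> 'a \<Rightarrow> real ^ 'd"
    and F :: "real \<Rightarrow> 'a measure"
    and L U :: "real \<Rightarrow> 'a \<Rightarrow> real"
  assumes "prob_space M"
    and "0 < T"
    and "brownian_motion M {0..T} B"
    and "P = completion M"
    and "F = augmented_filtration M {0..T} B"
    and "optional_process (space P) F T L" and "optional_process (space P) F T U"
    and "class_D P F T L" and "class_D P F T U"
    and "process_le P T L U"
    and "AE \<omega> in P. left_limited T (\<lambda>t. L t \<omega>)"
    and "AE \<omega> in P. left_limited T (\<lambda>t. U t \<omega>)"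
    and "AE \<omega> in P. \<forall>t\<in>{0..<T}.
           Limsup (at_right t) (\<lambda>s. ereal (L s \<omega>)) < Liminf (at_right t) (\<lambda>s. ereal (U s \<omega>))"
    and "AE \<omega> in P. \<forall>t\<in>{0<..T}.
           Lim (at_left t) (\<lambda>s. L s \<omega>) < Lim (at_left t) (\<lambda>s. U s \<omega>)"
  shows "weak_mokobodzki P F T L U"
proof -
  have B: "B s \<in> borel_measurable M" if "s \<in> {0..T}" for s
    using assms(3) that unfolding brownian_motion_def by blast
  have sub: "subalgebra P (F t)" for t
    unfolding assms(4,5) using B by (rule subalgebra_augmented_filtration)
  have finite_P: "finite_measure P"
    unfolding assms(4)
    by (intro prob_space.finite_measure prob_space.prob_space_completion assms(1))

  have "AE \<omega> in P. (\<forall>t\<in>{0..T}. L t \<omega> \<le> U t \<omega>) \<and> finite_variation T (lazy_path (\<lambda>t. L t \<omega>) (\<lambda>t. U t \<omega>))"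
    using assms(10)[unfolded process_le_def] assms(11-14)
  proof eventually_elim
    case (elim \<omega>)
    have "finite_variation T (lazy_path (\<lambda>t. L t \<omega>) (\<lambda>t. U t \<omega>))"
    proof (rule finite_variation_lazy_path)
      show "0 \<le> T" using \<open>0 < T\<close> by simp
      show "L t \<omega> \<le> U t \<omega>" if "0 \<le> t" "t \<le> T" for t
        using elim(1) that by simp
      show "\<exists>c. eventually (\<lambda>s. L s \<omega> \<le> c \<and> c \<le> U s \<omega>) (at_left t)" if "0 < t" "t \<le> T" for t
        using elim(2,3,5) that by (intro eventually_separated_at_left) auto
      show "\<exists>c. eventually (\<lambda>s. L s \<omega> \<le> c \<and> c \<le> U s \<omega>) (at_right t)" if "0 \<le> t" "t < T" for t
        using elim(4) that by (intro eventually_separated_if_Limsup_less_Liminf) auto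
    qed
    with elim(1) show ?case by blast
  qed
  then obtain Z where Z: "Z \<in> null_sets P"
    and le: "\<And>\<omega> t. \<omega> \<in> space P - Z \<Longrightarrow> 0 \<le> t \<Longrightarrow> t \<le> T \<Longrightarrow> L t \<omega> \<le> U t \<omega>"
    and FV: "\<And>\<omega>. \<omega> \<in> space P - Z \<Longrightarrow> finite_variation T (lazy_path (\<lambda>t. L t \<omega>) (\<lambda>t. U t \<omega>))"
    by (elim AE_E3) auto
  \<comment> \<open>The paths on \<open>Z\<close> must have finite variation too, and the constant \<open>0\<close> keeps \<open>V\<close> adapted because
    \<open>Z\<close> belongs to every \<open>F t\<close>.\<close>
  define V where "V t \<omega> = (if \<omega> \<in> Z then 0 else lazy_path (\<lambda>t. L t \<omega>) (\<lambda>t. U t \<omega>) t)" for t \<omega>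

  have "adapted F T V"
    unfolding adapted_def
  proof
    fix t assume t: "t \<in> {0..T}"
    have space_F: "space (F t) = space P"
      using sub by (simp add: subalgebra_def)
    have Z_F: "Z \<in> sets (F t)"
      using Z null_sets_subset_augmented_filtration unfolding assms(4,5) by blast
    let ?N = "restr_to_subalg P (F t)"
    have sets_N: "sets ?N = sets (F t)"
      by (rule sets_restr_to_subalg[OF sub])
    have "(\<lambda>(s, \<omega>). L s \<omega>) \<in> borel_measurable (restrict_space borel {0..t} \<Otimes>\<^sub>M ?N)"
      "(\<lambda>(s, \<omega>). U s \<omega>) \<in> borel_measurable (restrict_space borel {0..t} \<Otimes>\<^sub>M ?N)"
      using assms(8,9) t unfolding class_D_def progressively_measurable_def
      by (simp_all add: sets_N cong: measurable_cong_sets)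
    moreover have "complete_measure ?N"
      unfolding assms(4,5) using B by (rule complete_measure_restr_augmented_filtration)
    ultimately have kept: "{\<omega>\<in>space P. b \<in> kept_levels (\<lambda>s. L s \<omega>) (\<lambda>s. U s \<omega>) t} \<in> sets (F t)" for b
      using measurable_kept_levels[of ?N L t U b] t
        finite_measure_restr_to_subalg[OF sub finite_P]
      unfolding sets_N space_restr_to_subalg by simp
    show "V t \<in> borel_measurable (F t)"
      unfolding borel_measurable_iff_greater
    proof
      fix a
      have "{\<omega>\<in>space (F t). a < V t \<omega>} = (if a < 0 then Z else {}) \<union>
          ((\<Union>b\<in>\<rat> \<inter> {a<..}. {\<omega>\<in>space P. b \<in> kept_levels (\<lambda>s. L s \<omega>) (\<lambda>s. U s \<omega>) t}) - Z)"
      proof -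
        have "a < lazy_path (\<lambda>t. L t \<omega>) (\<lambda>t. U t \<omega>) t
            \<longleftrightarrow> (\<exists>b\<in>\<rat>. a < b \<and> b \<in> kept_levels (\<lambda>t. L t \<omega>) (\<lambda>t. U t \<omega>) t)"
          if "\<omega> \<in> space P - Z" for \<omega>
          using le[OF that] t by (intro less_lazy_path_iff[where T = T]) auto
        moreover have "Z \<subseteq> space P"
          using sets.sets_into_space[OF Z_F] space_F by simp
        ultimately show ?thesis
          unfolding V_def space_F by (auto split: if_splits)
      qed
      also have "\<dots> \<in> sets (F t)"
        using kept Z_F countable_rat by (intro sets.Un sets.Diff sets.countable_UN') auto
      finally show "{\<omega>\<in>space (F t). a < V t \<omega>} \<in> sets (F t)" .
    qed
  qed
  moreover have "finite_variation T (\<lambda>t. V t \<omega>)" if "\<omega> \<in> space P" for \<omega>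
  proof (cases "\<omega> \<in> Z")
    case True
    then show ?thesis by (auto simp: V_def finite_variation_def)
  next
    case False
    then show ?thesis using FV that by (simp add: V_def)
  qed
  moreover have "local_martingale P F T (\<lambda>_ _. 0)"
    using finite_P sub \<open>0 < T\<close> by (intro local_martingale_zero) auto
  ultimately have "semimartingale P F T V"
    unfolding semimartingale_def by (intro exI[of _ "\<lambda>_ _. 0"] exI[of _ V]) simp
  moreover have bounds: "L t \<omega> \<le> V t \<omega> \<and> V t \<omega> \<le> U t \<omega>"
    if \<omega>: "\<omega> \<in> space P - Z" and t: "t \<in> {0..T}" for \<omega> t
  proof -
    have "L t \<omega> \<le> lazy_path (\<lambda>t. L t \<omega>) (\<lambda>t. U t \<omega>) t"
      using t le[OF \<omega>] by (intro lower_le_lazy_path[of T "\<lambda>t. L t \<omega>" "\<lambda>t. U t \<omega>"]) auto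
    moreover have "lazy_path (\<lambda>t. L t \<omega>) (\<lambda>t. U t \<omega>) t \<le> U t \<omega>"
      using t le[OF \<omega>] by (intro lazy_path_le_upper[of T "\<lambda>t. L t \<omega>" "\<lambda>t. U t \<omega>"]) auto
    ultimately show ?thesis
      using \<omega> by (simp add: V_def)
  qed
  have "process_le P T L V" "process_le P T V U"
    unfolding process_le_def using bounds by (auto intro!: AE_I'[OF Z])
  ultimately show ?thesis
    unfolding weak_mokobodzki_def by blast
qed

end
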